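(* Let $F$ be a field with $\operatorname{char}(F)\neq 2$ and let $L$ be a finite dimensional pure nilpotent Lie algebra over $F$ with $b(L)=2$ and $\dim[L,L]=3=\dim(L/Z(L))$, where $Z(L)$ is the center of $L$. Then one of the following holds: (1) $L$ has a basis $\{x_1,x_2,x_3,z_1,z_2\}$ with $[x_1,x_2]=x_3$, $[x_1,x_3]=z_1$, $[x_2,x_3]=z_2$; or (2) $L$ has a basis $\{x_1,x_2,x_3,z_1,z_2,z_3\}$ with $[x_1,x_2]=z_1$, $[x_1,x_3]=z_2$, $[x_2,x_3]=z_3$. In each case all brackets of basis vectors not listed (apart from those determined by antisymmetry) are zero.
   Context: For a finite dimensional Lie algebra $L$ and $x\in L$, $\operatorname{ad}_x:L\to L$ denotes the map $y\mapsto [x,y]$. The breadth of $L$ is $b(L)=\max\{\operatorname{rank}(\operatorname{ad}_x)\mid x\in L\}$. A Lie algebra is called pure if it does not have a (nonzero) abelian ideal as a direct summand; equivalently, $Z(L)\subseteq [L,L]$. *)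

theory Defs
  imports Complex_Main "HOL-Library.Set_Algebras"
begin

locale lie_algebra = vector_space scale
  for scale :: "'f::field \<Rightarrow> 'v::ab_group_add \<Rightarrow> 'v" +
  fixes bracket :: "'v \<Rightarrow> 'v \<Rightarrow> 'v"
  assumes bracket_add_left: "bracket (x + y) z = bracket x z + bracket y z"
    and bracket_add_right: "bracket x (y + z) = bracket x y + bracket x z"
    and bracket_scale_left: "bracket (scale c x) y = scale c (bracket x y)"
    and bracket_scale_right: "bracket x (scale c y) = scale c (bracket x y)"
    and bracket_self: "bracket x x = 0"
    and jacobi: "bracket x (bracket y z) + bracket y (bracket z x) + bracket z (bracket x y) = 0"
begin

definition basis_list :: "'v list \<Rightarrow> bool" where
  "basis_list xs \<longleftrightarrow> distinct xs \<and> independent (set xs) \<and> span (set xs) = UNIV"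

definition coset :: "'v set \<Rightarrow> 'v \<Rightarrow> 'v set" where
  "coset W x = {x + w | w. w \<in> W}"

definition quotient_space :: "'v set \<Rightarrow> 'v set set" where
  "quotient_space W = range (coset W)"

text \<open>
  In the quotient by a subspace \<open>W\<close>, the sum of two cosets is their elementwise sum and \<open>W\<close> is the
  zero vector. The scalar multiple of a coset \<open>A\<close> by \<open>r\<close> is \<open>W + scale r ` A\<close>; the summand \<open>W\<close>
  matters only for \<open>r = 0\<close>. Below, the sum over \<open>C\<close> is the elementwise sum of sets, and a single
  summand \<open>W\<close> suffices because \<open>W + W = W\<close>; it also gives the empty combination the value \<open>W\<close>.
\<close>
definition quotient_combination :: "'v set \<Rightarrow> ('v set \<Rightarrow> 'f) \<Rightarrow> 'v set set \<Rightarrow> 'v set" where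
  "quotient_combination W r C = W + (\<Sum>A\<in>C. scale (r A) ` A)"

definition quotient_basis :: "'v set \<Rightarrow> 'v set set \<Rightarrow> bool" where
  "quotient_basis W C \<longleftrightarrow>
     finite C \<and> C \<subseteq> quotient_space W \<and>
     (\<forall>r. quotient_combination W r C = W \<longrightarrow> (\<forall>A\<in>C. r A = 0)) \<and>
     (\<forall>A\<in>quotient_space W. \<exists>r. A = quotient_combination W r C)"

text \<open>Only meaningful when the quotient is finite dimensional; otherwise the value is 0.\<close>
definition quotient_dim :: "'v set \<Rightarrow> nat" where
  "quotient_dim W = (if \<exists>C. quotient_basis W C then card (SOME C. quotient_basis W C) else 0)"

definition ad :: "'v \<Rightarrow> 'v \<Rightarrow> 'v" where
  "ad x y = bracket x y"

definition breadth :: nat where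
  "breadth = Max {dim (range (ad x)) | x. True}"

definition center :: "'v set" where
  "center = {z. \<forall>x. bracket z x = 0}"

definition bracket_span :: "'v set \<Rightarrow> 'v set \<Rightarrow> 'v set" where
  "bracket_span A B = span {bracket a b | a b. a \<in> A \<and> b \<in> B}"

definition derived_algebra :: "'v set" where
  "derived_algebra = bracket_span UNIV UNIV"

primrec lower_central_series :: "nat \<Rightarrow> 'v set" where
  "lower_central_series 0 = UNIV"
| "lower_central_series (Suc n) = bracket_span UNIV (lower_central_series n)"

definition nilpotent :: bool where
  "nilpotent \<longleftrightarrow> (\<exists>n. lower_central_series n = {0})"

definition lie_ideal :: "'v set \<Rightarrow> bool" where
  "lie_ideal I \<longleftrightarrow> subspace I \<and> (\<forall>x. \<forall>y\<in>I. bracket x y \<in> I)"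

definition abelian_ideal :: "'v set \<Rightarrow> bool" where
  "abelian_ideal I \<longleftrightarrow> lie_ideal I \<and> (\<forall>x\<in>I. \<forall>y\<in>I. bracket x y = 0)"

text \<open>Direct summand in the sense of Lie algebras: the complement is an ideal as well.\<close>
definition direct_summand :: "'v set \<Rightarrow> bool" where
  "direct_summand I \<longleftrightarrow>
     lie_ideal I \<and> (\<exists>J. lie_ideal J \<and> I \<inter> J = {0} \<and> I + J = UNIV)"

definition pure_algebra :: bool where
  "pure_algebra \<longleftrightarrow> \<not> (\<exists>I. abelian_ideal I \<and> I \<noteq> {0} \<and> direct_summand I)"

end

locale finite_dimensional_lie_algebra = lie_algebra +
  assumes finite_dimensional: "\<exists>B. finite B \<and> span B = UNIV"

end

theory Submission
  imports Defs
begin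

text \<open>
  Write \<open>Z\<close> for the center and \<open>D\<close> for the derived algebra. Purity gives \<open>Z \<subseteq> D\<close>: a central
  vector outside \<open>D\<close> would span an abelian ideal with a complement containing \<open>D\<close>, and a subspace
  containing \<open>D\<close> is an ideal (\<open>center_subset_derived_if_pure\<close>).

  If \<open>x, y, z\<close> span the algebra modulo \<open>Z\<close>, then the three brackets \<open>[x,y], [x,z], [y,z]\<close> span \<open>D\<close>
  (\<open>derived_algebra_eq_span_brackets\<close>). As \<open>D\<close> has dimension three, they are a basis of \<open>D\<close>. This
  holds for every choice of \<open>x, y, z\<close>, and the two normal forms come from two choices.

  If \<open>D \<subseteq> Z\<close>, then \<open>D = Z\<close>, and any three representatives of a basis of the quotient by \<open>Z\<close> give
  the six-dimensional form, with the three brackets as a basis of the center.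

  Otherwise, nilpotency makes the quotient by \<open>Z\<close> a Heisenberg algebra. Concretely, the last term of
  the lower central series that is not contained in \<open>Z\<close> contains a noncentral bracket
  \<open>c = [a,b]\<close> with every \<open>[y,c]\<close> central (\<open>nilpotent_last_noncentral_bracket\<close>). Bracketing a linear
  relation modulo \<open>Z\<close> with \<open>a\<close> and with \<open>b\<close> shows that \<open>a, b, c\<close> are independent modulo \<open>Z\<close>
  (\<open>independent_mod_center_bracket_triple\<close>), so they span modulo \<open>Z\<close> by dimension. Now \<open>D\<close> has the
  basis \<open>c, [a,c], [b,c]\<close>, whose last two members are central while \<open>c\<close> is not. Since
  \<open>Z \<subseteq> D\<close>, it follows that \<open>Z\<close> is spanned by \<open>[a,c]\<close> and \<open>[b,c]\<close>, which is the five-dimensional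
  form.
\<close>

section \<open>Independent and spanning families\<close>

context vector_space
begin

text \<open>
  A member depending on the others could be dropped from the spanning set, leaving too few vectors.
\<close>
lemma independent_if_card_le_dim_span:
  assumes "finite S" and "card S \<le> dim (span S)"
  shows "independent S"
proof
  assume "dependent S"
  then obtain a where a: "a \<in> S" "a \<in> span (S - {a})"
    unfolding dependent_def by blast
  have "S \<subseteq> span (S - {a})"
    using a by (auto intro: span_base)
  then have "span S \<subseteq> span (S - {a})"
    by (simp add: span_minimal)
  then have "dim (span S) \<le> card (S - {a})"
    using assms(1) by (intro dim_le_card) auto
  also have "\<dots> < card S"
    using a(1) assms(1) by (intro card_Diff1_less)
  finally show False using assms(2) by simp
qed

lemma span_eq_UNIV_if_independent_card_ge:
  assumes "finite T" and "span T = UNIV" and "independent S" and "card T \<le> card S"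
  shows "span S = UNIV"
proof -
  have "a \<in> span S" for a
  proof (rule ccontr)
    assume a: "a \<notin> span S"
    have "finite S"
      using independent_span_bound[OF assms(1,3)] assms(2) by simp
    moreover have "a \<notin> S"
      using a span_base by blast
    ultimately have "card (insert a S) > card T"
      using assms(4) by simp
    moreover have "card (insert a S) \<le> card T"
      using independent_span_bound[OF assms(1) independent_insertI[OF a assms(3)]] assms(2) by simp
    ultimately show False by simp
  qed
  then show ?thesis by auto
qed

text \<open>
  Vectors independent modulo \<open>span B\<close> can be added to \<open>B\<close> one at a time, each lying outside the
  span of what is already there. The disequalities are part of the conclusion because bases are
  counted by cardinality and listed as distinct lists.
\<close>
lemma independent_triple_append:
  assumes trivial: "\<And>a b c. scale a x + scale b y + scale c z \<in> span B \<Longrightarrow> a = 0 \<and> b = 0 \<and> c = 0"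
    and B: "independent B"
  shows "independent ({x, y, z} \<union> B)"
    and "x \<noteq> y" "x \<noteq> z" "y \<noteq> z" "x \<notin> B" "y \<notin> B" "z \<notin> B"
proof -
  have z: "z \<notin> span B"
    using trivial[of 0 0 1] by auto
  have y: "y \<notin> span (insert z B)"
  proof
    assume "y \<in> span (insert z B)"
    then obtain k where "y - scale k z \<in> span B" by (auto simp: span_breakdown_eq)
    then show False using trivial[of 0 1 "- k"] by simp
  qed
  have x: "x \<notin> span (insert y (insert z B))"
  proof
    assume "x \<in> span (insert y (insert z B))"
    then obtain k l where "x - scale k y - scale l z \<in> span B"
      by (auto simp: span_breakdown_eq)
    then show False using trivial[of 1 "- k" "- l"] by simp
  qed
  show "independent ({x, y, z} \<union> B)"
    using x y z B by (simp add: independent_insertI)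
  show "x \<noteq> y" "x \<noteq> z" "y \<noteq> z" "x \<notin> B" "y \<notin> B" "z \<notin> B"
    using x y z by (auto intro: span_base)
qed

lemma span_Un_span_right: "span (A \<union> span B) = span (A \<union> B)"
  by (simp only: span_Un span_span)

lemma set_sum_subset_subspace:
  assumes "subspace V" and "\<And>i. i \<in> I \<Longrightarrow> f i \<subseteq> V"
  shows "(\<Sum>i\<in>I. f i) \<subseteq> V"
  using assms(2)
proof (induction I rule: infinite_finite_induct)
  case (insert i I)
  then have "f i \<subseteq> V" "sum f I \<subseteq> V" by auto
  then have "f i + sum f I \<subseteq> V"
    using subspace_add[OF assms(1)] unfolding set_plus_def by blast
  with insert show ?case by simp
qed (simp_all add: set_zero subspace_0[OF assms(1)])

end

section \<open>Brackets, the center and the derived algebra\<close>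

context lie_algebra
begin

lemma bracket_zero_left [simp]: "bracket 0 x = 0"
  using bracket_add_left[of 0 0 x] by simp

lemma bracket_zero_right [simp]: "bracket x 0 = 0"
  using bracket_add_right[of x 0 0] by simp

lemma bracket_swap: "bracket y x = - bracket x y"
proof -
  have "0 = bracket (x + y) (x + y)" by (simp only: bracket_self)
  also have "\<dots> = (bracket x x + bracket y x) + (bracket x y + bracket y y)"
    by (simp only: bracket_add_left bracket_add_right)
  also have "\<dots> = bracket y x + bracket x y" by (simp add: bracket_self)
  finally have "bracket y x + bracket x y = 0" by (rule sym)
  then show ?thesis by (simp add: eq_neg_iff_add_eq_0)
qed

lemma bracket_center_left: "z \<in> center \<Longrightarrow> bracket z x = 0"
  by (simp add: center_def)

lemma bracket_center_right: "z \<in> center \<Longrightarrow> bracket x z = 0"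
  using bracket_swap[of x z] by (simp add: center_def)

lemma subspace_center: "subspace center"
  by (rule subspaceI) (auto simp: center_def bracket_add_left bracket_scale_left)

lemma bracket_in_derived_algebra: "bracket x y \<in> derived_algebra"
  unfolding derived_algebra_def bracket_span_def by (rule span_base) auto

lemma subspace_derived_algebra: "subspace derived_algebra"
  unfolding derived_algebra_def bracket_span_def by (rule subspace_span)

lemma bracket_mem_if_generators:
  assumes V: "subspace V" and gen: "\<And>x y. x \<in> X \<Longrightarrow> y \<in> Y \<Longrightarrow> bracket x y \<in> V"
    and u: "u \<in> span X" and v: "v \<in> span Y"
  shows "bracket u v \<in> V"
proof -
  have *: "bracket x v \<in> V" if "x \<in> X" for x
  proof -
    have "subspace {v. bracket x v \<in> V}"
      using V unfolding subspace_def by (simp add: bracket_add_right bracket_scale_right)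
    then have "span Y \<subseteq> {v. bracket x v \<in> V}"
      using gen that by (intro span_minimal) auto
    with v show ?thesis by blast
  qed
  have "subspace {u. bracket u v \<in> V}"
    using V unfolding subspace_def by (simp add: bracket_add_left bracket_scale_left)
  then have "span X \<subseteq> {u. bracket u v \<in> V}"
    using * by (intro span_minimal) auto
  with u show ?thesis by blast
qed

text \<open>
  Central generators do not contribute to brackets, and antisymmetry leaves three brackets among
  the remaining generators.
\<close>
lemma derived_algebra_eq_span_brackets:
  assumes "span ({x, y, z} \<union> center) = UNIV"
  shows "derived_algebra = span {bracket x y, bracket x z, bracket y z}" (is "_ = ?V")
proof
  let ?G = "{x, y, z} \<union> center"
  have base: "bracket x y \<in> ?V" "bracket x z \<in> ?V" "bracket y z \<in> ?V"
    by (auto intro: span_base)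
  have "bracket u v \<in> ?V" if "u \<in> ?G" "v \<in> ?G" for u v
  proof (cases "u \<in> center \<or> v \<in> center")
    case True
    then show ?thesis by (auto simp: bracket_center_left bracket_center_right span_zero)
  next
    case False
    with that have "u \<in> {x, y, z}" "v \<in> {x, y, z}" by auto
    then show ?thesis
      using base bracket_swap[of y x] bracket_swap[of z x] bracket_swap[of z y]
      by (auto simp: bracket_self span_zero span_neg)
  qed
  then have "bracket u v \<in> ?V" for u v
    using bracket_mem_if_generators[of ?V ?G ?G u v] assms by auto
  then show "derived_algebra \<subseteq> ?V"
    unfolding derived_algebra_def bracket_span_def by (intro span_minimal) auto
  show "?V \<subseteq> derived_algebra"
    by (intro span_minimal) (auto simp: bracket_in_derived_algebra subspace_derived_algebra)
qed

lemma brackets_independent_if_dim_derived: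
  assumes "span ({x, y, z} \<union> center) = UNIV" and "dim derived_algebra = 3"
  shows "independent {bracket x y, bracket x z, bracket y z}" (is "independent ?B")
    and "distinct [bracket x y, bracket x z, bracket y z]"
proof -
  have dim: "dim (span ?B) = 3"
    using assms derived_algebra_eq_span_brackets by simp
  have upper: "card ?B \<le> 3"
    using card_length[of "[bracket x y, bracket x z, bracket y z]"] by simp
  show "independent ?B"
    using upper dim by (intro independent_if_card_le_dim_span) auto
  have "dim (span ?B) \<le> card ?B"
    by (intro dim_le_card) auto
  then have "card ?B = 3" using dim upper by simp
  then show "distinct [bracket x y, bracket x z, bracket y z]"
    by (intro card_distinct) simp
qed

text \<open>
  Linear independence of the images in the quotient by the center, expressed by representatives. The
  vectors are listed rather than collected in a set, so that equal vectors count as dependent.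
\<close>
definition independent_mod_center :: "'v \<Rightarrow> 'v \<Rightarrow> 'v \<Rightarrow> bool" where
  "independent_mod_center x y z \<longleftrightarrow>
     (\<forall>a b c. scale a x + scale b y + scale c z \<in> center \<longrightarrow> a = 0 \<and> b = 0 \<and> c = 0)"

lemma independent_mod_center_append:
  assumes indep: "independent_mod_center x y z" and B: "independent B" "span B = center"
  shows "independent ({x, y, z} \<union> B)"
    and "x \<noteq> y" "x \<noteq> z" "y \<noteq> z" "x \<notin> B" "y \<notin> B" "z \<notin> B"
proof -
  have trivial: "a = 0 \<and> b = 0 \<and> c = 0" if "scale a x + scale b y + scale c z \<in> span B" for a b c
    using that indep B(2) unfolding independent_mod_center_def by blast
  note * = independent_triple_append[OF trivial B(1)]
  show "independent ({x, y, z} \<union> B)" by (rule *(1))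
  show "x \<noteq> y" "x \<noteq> z" "y \<noteq> z" "x \<notin> B" "y \<notin> B" "z \<notin> B" by (simp_all add: *(2-7))
qed

text \<open>
  Bracketing a central combination with \<open>x\<close> and then with \<open>y\<close> turns it into linear relations between
  \<open>[x,y]\<close> and \<open>[x,z]\<close>, and these two brackets are independent.
\<close>
lemma independent_mod_center_if_dim_derived:
  assumes "span ({x, y, z} \<union> center) = UNIV" and "dim derived_algebra = 3"
  shows "independent_mod_center x y z"
  unfolding independent_mod_center_def
proof (intro allI impI)
  fix a b c
  assume central: "scale a x + scale b y + scale c z \<in> center"
  note ind = brackets_independent_if_dim_derived(1)[OF assms]
  note dist = brackets_independent_if_dim_derived(2)[OF assms]
  have pair: "s = 0 \<and> t = 0"
    if "scale s u + scale t v = 0" "u \<noteq> v" "u \<in> {bracket x y, bracket x z, bracket y z}"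
      "v \<in> {bracket x y, bracket x z, bracket y z}" for s t u v
  proof -
    have "{u, v} \<subseteq> {bracket x y, bracket x z, bracket y z}"
      using that(3,4) by blast
    with ind have "independent {u, v}" by (rule independent_mono)
    then have "(if w = u then s else t) = 0" if "w \<in> {u, v}" for w
      using that \<open>scale s u + scale t v = 0\<close> \<open>u \<noteq> v\<close>
      by (intro independentD[of "{u, v}" "{u, v}" "\<lambda>w. if w = u then s else t"]) auto
    from this[of u] this[of v] show ?thesis using that(2) by simp
  qed
  have "bracket x (scale a x + scale b y + scale c z) = 0"
    by (rule bracket_center_right[OF central])
  then have "scale b (bracket x y) + scale c (bracket x z) = 0"
    by (simp add: bracket_add_right bracket_scale_right bracket_self)
  then have bc: "b = 0 \<and> c = 0"
    using dist by (intro pair[of b "bracket x y" c "bracket x z"]) auto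
  have "bracket (scale a x + scale b y + scale c z) y = 0"
    by (rule bracket_center_left[OF central])
  then have "scale a (bracket x y) + scale 0 (bracket x z) = 0"
    using bc by (simp add: bracket_add_left bracket_scale_left)
  then have "a = 0 \<and> 0 = (0::'f)"
    using dist by (intro pair[of a "bracket x y" 0 "bracket x z"]) auto
  with bc show "a = 0 \<and> b = 0 \<and> c = 0" by simp
qed

text \<open>
  Both normal forms are assembled in this way: a basis modulo the center, followed by a basis of the
  center.
\<close>
lemma basis_list_append_center_basis:
  assumes "independent_mod_center x y z" and "span ({x, y, z} \<union> center) = UNIV"
    and "distinct zs" and "independent (set zs)" and "span (set zs) = center"
  shows "basis_list (x # y # z # zs)"
proof -
  note ind = independent_mod_center_append[OF assms(1,4,5)]
  have "span ({x, y, z} \<union> set zs) = span ({x, y, z} \<union> center)"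
    using assms(5) span_Un_span_right by metis
  then have "span (set (x # y # z # zs)) = UNIV"
    using assms(2) by simp
  then show ?thesis
    using ind assms(3) by (simp add: basis_list_def)
qed

section \<open>Purity, quotient dimension and nilpotency\<close>

text \<open>
  Let \<open>z\<close> be central and outside the derived algebra. A basis of the derived algebra together with
  \<open>z\<close> extends to a basis \<open>E\<close> of the whole space, and \<open>E - {z}\<close> spans a complement of the line through
  \<open>z\<close>. It contains all brackets, so it is an ideal, and the line is an abelian direct summand.
\<close>
lemma center_subset_derived_if_pure:
  assumes pure_algebra
  shows "center \<subseteq> derived_algebra"
proof (rule ccontr)
  assume "\<not> center \<subseteq> derived_algebra"
  then obtain z where z: "z \<in> center" "z \<notin> derived_algebra" by blast
  obtain B where B: "B \<subseteq> derived_algebra" "independent B" "derived_algebra \<subseteq> span B"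
    using maximal_independent_subset by blast
  have "span B = derived_algebra"
    using B by (simp add: span_minimal subspace_derived_algebra subset_antisym)
  then have "independent (insert z B)" and "z \<notin> B"
    using B(1,2) z(2) by (auto simp: independent_insertI)
  then obtain E where E: "insert z B \<subseteq> E" "independent E" "UNIV \<subseteq> span E"
    using maximal_independent_subset_extend[of "insert z B" UNIV] by auto
  define J where "J = span (E - {z})"
  have zJ: "z \<notin> J"
    using E(1,2) unfolding J_def dependent_def by auto
  have subJ: "subspace J"
    unfolding J_def by (rule subspace_span)
  have "derived_algebra \<subseteq> J"
    unfolding J_def \<open>span B = derived_algebra\<close>[symmetric]
    using E(1) \<open>z \<notin> B\<close> by (intro span_mono) auto
  then have idealJ: "lie_ideal J"
    using bracket_in_derived_algebra subJ unfolding lie_ideal_def by auto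
  have multiple: "\<exists>k. w = scale k z" if "w \<in> span {z}" for w
    using that by (auto simp: span_singleton)
  have central: "span {z} \<subseteq> center"
    using z(1) by (intro span_minimal) (auto simp: subspace_center)
  have idealI: "lie_ideal (span {z})"
    unfolding lie_ideal_def using central by (auto simp: bracket_center_right span_zero)
  have "abelian_ideal (span {z})"
    using idealI central unfolding abelian_ideal_def by (auto simp: bracket_center_right)
  moreover have "span {z} \<noteq> {0}"
    using zJ subspace_0[OF subJ] span_base[of z "{z}"] by auto
  moreover have "span {z} \<inter> J = {0}"
  proof -
    have "w = 0" if w: "w \<in> span {z}" "w \<in> J" for w
    proof -
      obtain k where k: "w = scale k z" using multiple w(1) by blast
      have "k = 0"
      proof (rule ccontr)
        assume "k \<noteq> 0"
        then have "z = scale (inverse k) w" by (simp add: k)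
        then show False using zJ subspace_scale[OF subJ w(2)] by metis
      qed
      with k show ?thesis by simp
    qed
    then show ?thesis using span_zero subspace_0[OF subJ] by auto
  qed
  moreover have "span {z} + J = UNIV"
  proof -
    have "w \<in> span {z} + J" for w
    proof -
      have "E = insert z (E - {z})" using E(1) by auto
      then have "w \<in> span (insert z (E - {z}))" using E(3) by auto
      then obtain k where "w - scale k z \<in> J"
        unfolding J_def span_breakdown_eq by blast
      moreover have "scale k z \<in> span {z}" by (simp add: span_base span_scale)
      ultimately have "scale k z + (w - scale k z) \<in> span {z} + J"
        by (intro set_plus_intro)
      then show ?thesis by simp
    qed
    then show ?thesis by auto
  qed
  ultimately show False
    using assms idealI idealJ unfolding pure_algebra_def direct_summand_def by blast
qed

text \<open>
  Representatives of a basis of cosets span the space modulo \<open>W\<close>. The dimension must be nonzero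
  because the value 0 also stands for a quotient without a finite basis.
\<close>
lemma quotient_dim_representatives:
  assumes W: "subspace W" and "quotient_dim W \<noteq> 0"
  obtains S where "finite S" "card S = quotient_dim W" "span (S \<union> W) = UNIV"
proof -
  have ex: "\<exists>C. quotient_basis W C"
    using assms(2) unfolding quotient_dim_def by presburger
  define C where "C = (SOME C. quotient_basis W C)"
  have C: "quotient_basis W C"
    unfolding C_def using ex by (rule someI_ex)
  have card_C: "quotient_dim W = card C"
    using ex by (simp add: quotient_dim_def C_def)
  have "\<forall>A\<in>C. \<exists>x. A = coset W x"
    using C unfolding quotient_basis_def quotient_space_def by auto
  then obtain rep where rep: "\<And>A. A \<in> C \<Longrightarrow> A = coset W (rep A)" by metis
  define S where "S = rep ` C"
  have "inj_on rep C"
    using rep by (metis inj_onI)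
  then have "card S = quotient_dim W"
    by (simp add: S_def card_image card_C)
  moreover have "finite S"
    using C unfolding S_def quotient_basis_def by simp
  moreover have "span (S \<union> W) = UNIV"
  proof -
    let ?V = "span (S \<union> W)"
    have "A \<subseteq> ?V" if "A \<in> C" for A
    proof -
      have "coset W (rep A) \<subseteq> ?V"
        using that unfolding coset_def S_def by (auto intro!: span_add intro: span_base)
      then show ?thesis using rep[OF that] by simp
    qed
    then have "scale k ` A \<subseteq> ?V" if "A \<in> C" for A k
      using that by (auto intro: span_scale)
    then have "(\<Sum>A\<in>C. scale (r A) ` A) \<subseteq> ?V" for r
      by (intro set_sum_subset_subspace) auto
    then have comb: "quotient_combination W r C \<subseteq> ?V" for r
      unfolding quotient_combination_def set_plus_def
      by (auto intro!: span_add intro: span_base)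
    have "x \<in> ?V" for x
    proof -
      have "x \<in> coset W x"
        unfolding coset_def using subspace_0[OF W] by force
      moreover have "\<exists>r. coset W x = quotient_combination W r C"
        using C unfolding quotient_basis_def quotient_space_def by auto
      ultimately show ?thesis using comb by auto
    qed
    then show ?thesis by auto
  qed
  ultimately show thesis using that by blast
qed

text \<open>
  Take the last term of the lower central series that is not contained in the center. It has positive
  index because the derived algebra is not central, so it is spanned by brackets, one of which is not
  central. Brackets with that element lie in the next term, which is central.
\<close>
lemma nilpotent_last_noncentral_bracket:
  assumes nilpotent and "\<not> derived_algebra \<subseteq> center"
  obtains a b where "bracket a b \<notin> center" "\<And>y. bracket y (bracket a b) \<in> center"
proof -
  let ?P = "\<lambda>n. lower_central_series n \<subseteq> center"
  obtain n where "lower_central_series n = {0}"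
    using assms(1) unfolding nilpotent_def by blast
  then have ex: "\<exists>n. ?P n"
    using subspace_0[OF subspace_center] by (intro exI[of _ n]) auto
  define m where "m = (LEAST n. ?P n)"
  have m: "?P m" and less_m: "\<And>i. i < m \<Longrightarrow> \<not> ?P i"
    unfolding m_def using ex LeastI_ex[of ?P] not_less_Least[of _ ?P] by blast+
  \<comment> \<open>The derived algebra is term 1 of the series, hence \<open>m \<ge> 2\<close> and term \<open>m - 1\<close> is spanned by brackets.\<close>
  have "\<not> ?P 0" "\<not> ?P (Suc 0)"
    using assms(2) by (auto simp: derived_algebra_def)
  with m have "m \<noteq> 0" "m \<noteq> Suc 0" by metis+
  then obtain k where "m = Suc (Suc k)"
    by (metis not0_implies_Suc)
  with m less_m have k: "\<not> ?P (Suc k)" "?P (Suc (Suc k))" by blast+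
  have "\<not> {bracket a b | a b. a \<in> UNIV \<and> b \<in> lower_central_series k} \<subseteq> center"
  proof
    assume "{bracket a b | a b. a \<in> UNIV \<and> b \<in> lower_central_series k} \<subseteq> center"
    then have "?P (Suc k)"
      by (simp add: bracket_span_def span_minimal subspace_center)
    with k(1) show False ..
  qed
  then obtain a b where ab: "b \<in> lower_central_series k" "bracket a b \<notin> center"
    by auto
  have step: "bracket y v \<in> lower_central_series (Suc m)" if "v \<in> lower_central_series m" for y v m
    using that by (auto simp: bracket_span_def intro: span_base)
  have "bracket y (bracket a b) \<in> center" for y
    using k(2) step[OF step[OF ab(1)]] by blast
  then show thesis using that ab(2) by blast
qed

text \<open>
  Modulo the center, bracketing \<open>r a + s b + t [a,b]\<close> with \<open>a\<close> leaves only \<open>s [a,b]\<close>, and bracketing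
  with \<open>b\<close> leaves only a multiple by \<open>r\<close>. As \<open>[a,b]\<close> is not central, the coefficients vanish.
\<close>
lemma independent_mod_center_bracket_triple:
  assumes noncentral: "bracket a b \<notin> center" and central: "\<And>y. bracket y (bracket a b) \<in> center"
  shows "independent_mod_center a b (bracket a b)"
  unfolding independent_mod_center_def
proof (intro allI impI)
  fix r s t
  let ?c = "bracket a b"
  let ?w = "scale r a + scale s b + scale t ?c"
  assume w: "?w \<in> center"
  have zero: "k = 0" if "scale k ?c \<in> center" for k
  proof (rule ccontr)
    assume "k \<noteq> 0"
    then have "?c = scale (inverse k) (scale k ?c)" by simp
    with subspace_scale[OF subspace_center that] noncentral show False by metis
  qed
  have "scale s ?c + scale t (bracket a ?c) = bracket a ?w"
    by (simp add: bracket_add_right bracket_scale_right bracket_self)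
  also have "\<dots> = 0" by (rule bracket_center_right[OF w])
  finally have "scale s ?c = scale (- t) (bracket a ?c)"
    by (simp add: eq_neg_iff_add_eq_0)
  then have s: "s = 0"
    by (intro zero) (simp only: subspace_scale[OF subspace_center central])
  have "scale r (bracket b a) + scale t (bracket b ?c) = bracket b ?w"
    by (simp add: bracket_add_right bracket_scale_right bracket_self)
  also have "\<dots> = 0" by (rule bracket_center_right[OF w])
  finally have "scale r ?c = scale t (bracket b ?c)"
    by (simp add: bracket_swap[of b a])
  then have r: "r = 0"
    by (intro zero) (simp only: subspace_scale[OF subspace_center central])
  have "t = 0" using w r s zero by simp
  with r s show "r = 0 \<and> s = 0 \<and> t = 0" by simp
qed

end

section \<open>The two normal forms\<close>

context finite_dimensional_lie_algebra
begin

text \<open>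
  Three vectors independent modulo the center span modulo the center whenever some three vectors do.
  Counting in the whole space, after adding a basis of the center, avoids linear algebra in the
  quotient; that this basis is finite comes from the finite dimension of the algebra.
\<close>
lemma span_Un_center_eq_UNIV:
  assumes S: "finite S" "card S = 3" "span (S \<union> center) = UNIV"
    and ind: "independent_mod_center x y z"
  shows "span ({x, y, z} \<union> center) = UNIV"
proof -
  obtain B where B: "B \<subseteq> center" "independent B" "center \<subseteq> span B"
    using maximal_independent_subset by blast
  have span_B: "span B = center"
    using B subspace_center by (simp add: span_minimal subset_antisym)
  have finite_B: "finite B"
    using finite_dimensional independent_span_bound[OF _ B(2)] by auto
  note triple = independent_mod_center_append[OF ind B(2) span_B]
  have "card ({x, y, z} \<union> B) = 3 + card B"
    using triple(2-7) finite_B by simp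
  moreover have "card (S \<union> B) \<le> 3 + card B"
    using card_Un_le[of S B] S(2) by simp
  moreover have "span (S \<union> B) = UNIV"
    using S(3) span_B span_Un_span_right by metis
  ultimately have "span ({x, y, z} \<union> B) = UNIV"
    using span_eq_UNIV_if_independent_card_ge[of "S \<union> B" "{x, y, z} \<union> B"] triple(1) S(1) finite_B
    by simp
  then show ?thesis
    using span_B span_Un_span_right by metis
qed

end

theorem theorem4p4:
  fixes scale :: "'f::field \<Rightarrow> 'v::ab_group_add \<Rightarrow> 'v"
    and bracket :: "'v \<Rightarrow> 'v \<Rightarrow> 'v"
  assumes "CHAR('f) \<noteq> 2"
    and "finite_dimensional_lie_algebra scale bracket"
    and "lie_algebra.pure_algebra scale bracket"
    and "lie_algebra.nilpotent scale bracket"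
    and "lie_algebra.breadth scale bracket = 2"
    and "vector_space.dim scale (lie_algebra.derived_algebra scale bracket) = 3"
    and "lie_algebra.quotient_dim scale (lie_algebra.center bracket) = 3"
  shows
    "(\<exists>x1 x2 x3 z1 z2.
        lie_algebra.basis_list scale [x1, x2, x3, z1, z2] \<and>
        bracket x1 x2 = x3 \<and> bracket x1 x3 = z1 \<and> bracket x2 x3 = z2 \<and>
        (\<forall>x\<in>{x1, x2, x3}. \<forall>z\<in>{z1, z2}. bracket x z = 0) \<and>
        (\<forall>z\<in>{z1, z2}. \<forall>z'\<in>{z1, z2}. bracket z z' = 0)) \<or>
     (\<exists>x1 x2 x3 z1 z2 z3.
        lie_algebra.basis_list scale [x1, x2, x3, z1, z2, z3] \<and>
        bracket x1 x2 = z1 \<and> bracket x1 x3 = z2 \<and> bracket x2 x3 = z3 \<and>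
        (\<forall>x\<in>{x1, x2, x3}. \<forall>z\<in>{z1, z2, z3}. bracket x z = 0) \<and>
        (\<forall>z\<in>{z1, z2, z3}. \<forall>z'\<in>{z1, z2, z3}. bracket z z' = 0))"
proof -
  interpret finite_dimensional_lie_algebra scale bracket by (rule assms(2))
  have dim: "dim derived_algebra = 3" by (rule assms(6))
  have ZD: "center \<subseteq> derived_algebra"
    by (rule center_subset_derived_if_pure[OF assms(3)])
  obtain S where S: "finite S" "card S = 3" "span (S \<union> center) = UNIV"
    using quotient_dim_representatives[OF subspace_center] assms(7) by auto
  show ?thesis
  proof (cases "derived_algebra \<subseteq> center")
    case True
    obtain x1 x2 x3 where "S = {x1, x2, x3}"
      using S(2) by (auto simp: card_3_iff)
    with S(3) have gen: "span ({x1, x2, x3} \<union> center) = UNIV" by simp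
    let ?zs = "[bracket x1 x2, bracket x1 x3, bracket x2 x3]"
    have "span (set ?zs) = center"
      using derived_algebra_eq_span_brackets[OF gen] True ZD by simp
    then have basis: "basis_list (x1 # x2 # x3 # ?zs)"
      using independent_mod_center_if_dim_derived[OF gen dim]
        brackets_independent_if_dim_derived[OF gen dim]
      by (intro basis_list_append_center_basis gen) auto
    have zero: "bracket u w = 0" if "w \<in> {bracket x1 x2, bracket x1 x3, bracket x2 x3}" for u w
      using that True bracket_in_derived_algebra by (blast intro: bracket_center_right)
    show ?thesis
      by (rule disjI2, rule exI[of _ x1], rule exI[of _ x2], rule exI[of _ x3],
          rule exI[of _ "bracket x1 x2"], rule exI[of _ "bracket x1 x3"],
          rule exI[of _ "bracket x2 x3"])
        (intro conjI ballI basis refl zero)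
  next
    case False
    obtain a b where ab: "bracket a b \<notin> center" "\<And>y. bracket y (bracket a b) \<in> center"
      using nilpotent_last_noncentral_bracket[OF assms(4) False] by blast
    let ?c = "bracket a b"
    let ?z1 = "bracket a ?c"
    let ?z2 = "bracket b ?c"
    have ind: "independent_mod_center a b ?c"
      by (rule independent_mod_center_bracket_triple[OF ab])
    have gen: "span ({a, b, ?c} \<union> center) = UNIV"
      by (rule span_Un_center_eq_UNIV[OF S ind])
    note brackets = brackets_independent_if_dim_derived[OF gen dim]
    have sub: "span {?z1, ?z2} \<subseteq> center"
      using ab(2) by (intro span_minimal subspace_center) auto
    have "center \<subseteq> span {?z1, ?z2}"
    proof
      fix z assume z: "z \<in> center"
      then have "z \<in> span (insert ?c {?z1, ?z2})"
        using ZD derived_algebra_eq_span_brackets[OF gen] by auto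
      then obtain k where k: "z - scale k ?c \<in> span {?z1, ?z2}"
        by (auto simp: span_breakdown_eq)
      with sub have "z - scale k ?c \<in> center" by blast
      \<comment> \<open>The \<open>?c\<close>-component of a central vector is itself central, hence zero.\<close>
      then have "z - (z - scale k ?c) \<in> center"
        by (rule subspace_diff[OF subspace_center z])
      then have "scale 0 a + scale 0 b + scale k ?c \<in> center" by simp
      then have "k = 0"
        using ind unfolding independent_mod_center_def by blast
      with k show "z \<in> span {?z1, ?z2}" by simp
    qed
    with sub have "span (set [?z1, ?z2]) = center" by auto
    moreover have "independent (set [?z1, ?z2])"
      using brackets(1) by (rule independent_mono) auto
    ultimately have basis: "basis_list (a # b # ?c # [?z1, ?z2])"
      using brackets(2) by (intro basis_list_append_center_basis ind gen) auto
    have zero: "bracket u w = 0" if "w \<in> {?z1, ?z2}" for u w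
      using that ab(2) by (blast intro: bracket_center_right)
    show ?thesis
      by (rule disjI1, rule exI[of _ a], rule exI[of _ b], rule exI[of _ ?c],
          rule exI[of _ ?z1], rule exI[of _ ?z2])
        (intro conjI ballI basis refl zero)
  qed
qed

end
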